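(* Let $b<c$ be real numbers. There exist boundary conditions $x_0,x_1\in\mathbb{R}^2$ with $x_0\neq x_1$ and $v_0,v_1\in\mathbb{R}^2\setminus\{0\}$ such that the cost $$J[\gamma]=\int_b^c \sqrt{\|\dot\gamma(t)\|^2+\|\dot\gamma(t)\|^2K_\gamma^2(t)}\,dt$$ does not admit a minimum over the set $$\mathcal{D}_2:=\{\gamma\in C^2([b,c],\mathbb{R}^2)\ :\ \|\dot\gamma(t)\|^2+\|\dot\gamma(t)\|^2K_\gamma^2(t)\in L^1([b,c],\mathbb{R}),\ \gamma(b)=x_0,\ \gamma(c)=x_1,\ \dot\gamma(b)\sim v_0,\ \dot\gamma(c)\sim v_1\}.$$
   Context: For a planar curve $\gamma(t)=(x(t),y(t))$, the curvature at a time $t$ with $\dot\gamma(t)\neq0$ is $K_\gamma(t)=\dfrac{\dot x\ddot y-\dot y\ddot x}{(\dot x^2+\dot y^2)^{3/2}}$; it is undefined where $\dot\gamma(t)=0$. Curves in $\mathcal{D}_2$ may have $\dot\gamma(t)=0$ at some times; the condition $\|\dot\gamma\|^2+\|\dot\gamma\|^2K_\gamma^2\in L^1$ is read as: this function is defined for almost every $t\in[b,c]$ and is integrable. For vectors $w_1,w_2\in\mathbb{R}^2$, $w_1\sim w_2$ means that there exists $\alpha>0$ with $w_1=\alpha w_2$ (same direction and same orientation). The norm $\|\cdot\|$ is the Euclidean norm. *)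

theory Defs
  imports "HOL-Analysis.Analysis"
begin

(* Derivatives relative to [b,c], hence one-sided at the endpoints: everything
   below depends only on the values of the curve on [b,c]. *)

definition velocity :: "real \<Rightarrow> real \<Rightarrow> (real \<Rightarrow> real^2) \<Rightarrow> real \<Rightarrow> real^2" where
  "velocity b c \<gamma> t = vector_derivative \<gamma> (at t within {b..c})"

definition acceleration :: "real \<Rightarrow> real \<Rightarrow> (real \<Rightarrow> real^2) \<Rightarrow> real \<Rightarrow> real^2" where
  "acceleration b c \<gamma> t = vector_derivative (velocity b c \<gamma>) (at t within {b..c})"

definition C2_curve :: "real \<Rightarrow> real \<Rightarrow> (real \<Rightarrow> real^2) \<Rightarrow> bool" where
  "C2_curve b c \<gamma> \<longleftrightarrow>
     \<gamma> differentiable_on {b..c} \<and>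
     velocity b c \<gamma> differentiable_on {b..c} \<and>
     continuous_on {b..c} (acceleration b c \<gamma>)"

(* Only meaningful where the velocity is nonzero (elsewhere the value is 0, by x / 0 = 0). *)
definition curvature :: "real \<Rightarrow> real \<Rightarrow> (real \<Rightarrow> real^2) \<Rightarrow> real \<Rightarrow> real" where
  "curvature b c \<gamma> t =
     (let v = velocity b c \<gamma> t; a = acceleration b c \<gamma> t
      in (v$1 * a$2 - v$2 * a$1) / ((v$1)\<^sup>2 + (v$2)\<^sup>2) powr (3/2))"

definition same_direction :: "real^2 \<Rightarrow> real^2 \<Rightarrow> bool" where
  "same_direction w1 w2 \<longleftrightarrow> (\<exists>\<alpha>>0. w1 = \<alpha> *\<^sub>R w2)"

definition energy :: "real \<Rightarrow> real \<Rightarrow> (real \<Rightarrow> real^2) \<Rightarrow> real \<Rightarrow> real" where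
  "energy b c \<gamma> t =
     (norm (velocity b c \<gamma> t))\<^sup>2 + (norm (velocity b c \<gamma> t))\<^sup>2 * (curvature b c \<gamma> t)\<^sup>2"

definition cost :: "real \<Rightarrow> real \<Rightarrow> (real \<Rightarrow> real^2) \<Rightarrow> real" where
  "cost b c \<gamma> = (LINT t:{b..c}|lborel. sqrt (energy b c \<gamma> t))"

(* The almost-everywhere clause says that the curvature, hence the energy, is defined
   at almost every time, so the value of curvature at zeros of the velocity is immaterial
   for members of D2. The integrand of cost is integrable for them, since
   sqrt u \<le> 1 + u for u \<ge> 0. *)
definition D2 ::
  "real \<Rightarrow> real \<Rightarrow> real^2 \<Rightarrow> real^2 \<Rightarrow> real^2 \<Rightarrow> real^2 \<Rightarrow> (real \<Rightarrow> real^2) set" where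
  "D2 b c x0 x1 v0 v1 =
     {\<gamma>. C2_curve b c \<gamma> \<and>
          (AE t in lborel. t \<in> {b..c} \<longrightarrow> velocity b c \<gamma> t \<noteq> 0) \<and>
          set_integrable lborel {b..c} (energy b c \<gamma>) \<and>
          \<gamma> b = x0 \<and> \<gamma> c = x1 \<and>
          same_direction (velocity b c \<gamma> b) v0 \<and>
          same_direction (velocity b c \<gamma> c) v1}"

end

(* Take x0 = 0, x1 = e1 and the opposite directions v0 = -e1, v1 = e1. The cost dominates the
   length, hence the integral of the first component of the velocity, which is 1; equality would
   force that component to be nonnegative throughout, whereas it is negative at time b. On the
   other hand, moving backwards along the line by a small amount before a cusp and then
   forwards costs arbitrarily little more than 1, as cusps contribute no curvature. *)

theory Submission
  imports Defs
begin

text \<open>As b < c, no point of the interval is isolated, so derivatives within it are unique,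
  including the one-sided ones at b and c.\<close>

lemma velocity_eq:
  assumes "b < c" "t \<in> {b..c}" "(\<gamma> has_vector_derivative v) (at t within {b..c})"
  shows "velocity b c \<gamma> t = v"
  unfolding velocity_def using assms vector_derivative_within_cbox[of b c t \<gamma> v]
  by (simp add: cbox_interval)

lemma C2_curve_has_velocity:
  assumes "C2_curve b c \<gamma>" "t \<in> {b..c}"
  shows "(\<gamma> has_vector_derivative velocity b c \<gamma> t) (at t within {b..c})"
  using assms unfolding C2_curve_def velocity_def differentiable_on_def
  by (simp add: vector_derivative_works)

lemma continuous_on_velocity:
  assumes "C2_curve b c \<gamma>"
  shows "continuous_on {b..c} (velocity b c \<gamma>)"
  using assms unfolding C2_curve_def by (blast intro: differentiable_imp_continuous_on)

lemma energy_ge: "(norm (velocity b c \<gamma> t))\<^sup>2 \<le> energy b c \<gamma> t"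
  unfolding energy_def by simp

text \<open>Domination by 1 + f, which is integrable because the interval is bounded. This makes the
  integrand of \<open>cost\<close> integrable whenever \<open>energy\<close> is, so that integrals
  can be compared.\<close>

lemma set_integrable_sqrt:
  fixes f :: "real \<Rightarrow> real"
  assumes int: "set_integrable lborel {b..c} f" and nonneg: "\<And>t. 0 \<le> f t"
  shows "set_integrable lborel {b..c} (\<lambda>t. sqrt (f t))"
proof -
  have one: "set_integrable lborel {b..c} (\<lambda>_. 1::real)"
    by (rule borel_integrable_atLeastAtMost') simp
  have "set_integrable lborel {b..c} (\<lambda>t. 1 + f t)"
    using one int by (rule set_integral_add)
  moreover have "set_borel_measurable lborel {b..c} (\<lambda>t. sqrt (f t))"
  proof -
    \<comment> \<open>The root may be taken outside the indicator because sqrt 0 = 0.\<close>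
    have "(\<lambda>t. sqrt (indicator {b..c} t *\<^sub>R f t)) \<in> borel_measurable lborel"
      using int unfolding set_integrable_def by measurable
    moreover have "(\<lambda>t. sqrt (indicator {b..c} t *\<^sub>R f t)) = (\<lambda>t. indicator {b..c} t *\<^sub>R sqrt (f t))"
      by (auto simp: indicator_def)
    ultimately show ?thesis unfolding set_borel_measurable_def by simp
  qed
  moreover have "sqrt (f t) \<le> 1 + f t" for t
    by (rule real_le_lsqrt) (use nonneg[of t] in \<open>auto simp: power2_eq_square algebra_simps\<close>)
  ultimately show ?thesis
    using nonneg by (elim set_integrable_bound) (auto simp: abs_of_nonneg add_nonneg_nonneg)
qed

text \<open>Dropping the curvature term leaves the speed, which dominates each component of the
  velocity. The lower bound is a gauge integral so that the fundamental theorem of calculus can be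
  applied to it.\<close>

lemma cost_ge_integral_abs_component:
  assumes C2: "C2_curve b c \<gamma>" and int: "set_integrable lborel {b..c} (energy b c \<gamma>)"
  shows "integral {b..c} (\<lambda>t. \<bar>velocity b c \<gamma> t $ i\<bar>) \<le> cost b c \<gamma>"
proof -
  have cont: "continuous_on {b..c} (\<lambda>t. \<bar>velocity b c \<gamma> t $ i\<bar>)"
    by (intro continuous_intros continuous_on_velocity C2)
  have "\<bar>velocity b c \<gamma> t $ i\<bar> \<le> sqrt (energy b c \<gamma> t)" for t
    using component_le_norm_cart[of "velocity b c \<gamma> t" i] real_le_rsqrt[OF energy_ge] by (meson order_trans)
  moreover have "set_integrable lborel {b..c} (\<lambda>t. sqrt (energy b c \<gamma> t))"
    using int by (rule set_integrable_sqrt) (simp add: energy_def)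
  ultimately have "(LINT t:{b..c}|lborel. \<bar>velocity b c \<gamma> t $ i\<bar>) \<le> cost b c \<gamma>"
    unfolding cost_def
    by (intro set_integral_mono borel_integrable_atLeastAtMost'[OF cont])
  then show ?thesis
    using set_borel_integral_eq_integral(2)[OF borel_integrable_atLeastAtMost'[OF cont]] by simp
qed

text \<open>The displacement is the integral of \<open>?v\<close>, and the cost is at least that of
  its absolute value. Strictness comes from continuity of the velocity: a negative value at b
  persists on a set of positive measure.\<close>

lemma cost_gt_displacement:
  assumes "b < c" and C2: "C2_curve b c \<gamma>" and int: "set_integrable lborel {b..c} (energy b c \<gamma>)"
    and neg: "velocity b c \<gamma> b $ i < 0"
  shows "\<gamma> c $ i - \<gamma> b $ i < cost b c \<gamma>"
proof -
  let ?v = "\<lambda>t. velocity b c \<gamma> t $ i"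
  have cont: "continuous_on {b..c} ?v"
    by (intro continuous_intros continuous_on_velocity C2)
  have ftc: "(?v has_integral (\<gamma> c $ i - \<gamma> b $ i)) {b..c}"
    using \<open>b < c\<close> C2_curve_has_velocity[OF C2]
    by (intro fundamental_theorem_of_calculus)
       (auto intro: bounded_linear.has_vector_derivative[OF bounded_linear_vec_nth])
  have contd: "continuous_on {b..c} (\<lambda>t. \<bar>?v t\<bar> - ?v t)"
    by (intro continuous_intros cont)
  \<comment> \<open>A continuous nonnegative function with zero integral vanishes everywhere, but
    the integrand is positive at b.\<close>
  have "integral {b..c} (\<lambda>t. \<bar>?v t\<bar> - ?v t) \<noteq> 0"
    by (subst integral_eq_0_iff[OF contd \<open>b < c\<close>]) (use neg \<open>b < c\<close> in \<open>auto intro!: bexI[of _ b]\<close>)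
  moreover have "integral {b..c} (\<lambda>t. \<bar>?v t\<bar> - ?v t) \<ge> 0"
    by (intro integral_nonneg integrable_continuous_real contd) simp
  moreover have "integral {b..c} (\<lambda>t. \<bar>?v t\<bar> - ?v t)
      = integral {b..c} (\<lambda>t. \<bar>?v t\<bar>) - (\<gamma> c $ i - \<gamma> b $ i)"
    using integral_unique[OF ftc]
    by (subst Henstock_Kurzweil_Integration.integral_diff)
       (auto intro!: integrable_continuous_real continuous_intros continuous_on_velocity C2)
  ultimately show ?thesis
    using cost_ge_integral_abs_component[OF C2 int, of i] by linarith
qed

text \<open>On a line, acceleration is parallel to velocity, so the numerator of the curvature
  vanishes and the cost is just the length, however often the motion reverses.\<close>

lemma straight_curve:
  fixes f f' f'' :: "real \<Rightarrow> real" and w :: "real^2"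
  assumes "b < c" and w: "norm w = 1"
    and f: "\<And>t. t \<in> {b..c} \<Longrightarrow> (f has_real_derivative f' t) (at t within {b..c})"
    and f': "\<And>t. t \<in> {b..c} \<Longrightarrow> (f' has_real_derivative f'' t) (at t within {b..c})"
    and f'': "continuous_on {b..c} f''"
  defines "\<gamma> \<equiv> \<lambda>t. f t *\<^sub>R w"
  shows "\<And>t. t \<in> {b..c} \<Longrightarrow> velocity b c \<gamma> t = f' t *\<^sub>R w"
    and "C2_curve b c \<gamma>"
    and "set_integrable lborel {b..c} (energy b c \<gamma>)"
    and "cost b c \<gamma> = integral {b..c} (\<lambda>t. \<bar>f' t\<bar>)"
proof -
  have der: "(\<gamma> has_vector_derivative f' t *\<^sub>R w) (at t within {b..c})" if "t \<in> {b..c}" for t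
    unfolding \<gamma>_def using has_vector_derivative_scaleR[OF f[OF that] has_vector_derivative_const[of w]]
    by simp
  show vel: "velocity b c \<gamma> t = f' t *\<^sub>R w" if "t \<in> {b..c}" for t
    using velocity_eq[OF \<open>b < c\<close> that der[OF that]] .
  have der2: "(velocity b c \<gamma> has_vector_derivative f'' t *\<^sub>R w) (at t within {b..c})"
    if "t \<in> {b..c}" for t
  \<comment> \<open>The formula for the velocity is known only on the interval, which suffices for a
    derivative within it.\<close>
  proof (rule has_vector_derivative_transform[OF that])
    show "((\<lambda>t. f' t *\<^sub>R w) has_vector_derivative f'' t *\<^sub>R w) (at t within {b..c})"
      using has_vector_derivative_scaleR[OF f'[OF that] has_vector_derivative_const[of w]] by simp
  qed (rule vel)
  \<comment> \<open>Acceleration is the velocity of the curve \<open>velocity b c \<gamma>\<close>,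
    so \<open>velocity_eq\<close> applies a second time.\<close>
  have acc: "acceleration b c \<gamma> t = f'' t *\<^sub>R w" if "t \<in> {b..c}" for t
    using velocity_eq[OF \<open>b < c\<close> that der2[OF that]] unfolding acceleration_def velocity_def .
  show "C2_curve b c \<gamma>"
    unfolding C2_curve_def differentiable_on_def
  proof (intro conjI ballI)
    show "continuous_on {b..c} (acceleration b c \<gamma>)"
      using f'' by (subst continuous_on_cong[OF refl acc]) (auto intro!: continuous_intros)
  qed (use der der2 in \<open>blast intro: differentiableI_vector\<close>)+
  \<comment> \<open>This holds at zeros of \<open>f'\<close> too, where the curvature is 0 / 0 =
    0.\<close>
  have en: "energy b c \<gamma> t = (f' t)\<^sup>2" if "t \<in> {b..c}" for t
    unfolding energy_def curvature_def Let_def vel[OF that] acc[OF that] using w by simp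
  have cont: "continuous_on {b..c} f'"
    using f' by (meson DERIV_continuous_on)
  have "set_integrable lborel {b..c} (\<lambda>t. (f' t)\<^sup>2)"
    by (intro borel_integrable_atLeastAtMost' continuous_intros cont)
  then show "set_integrable lborel {b..c} (energy b c \<gamma>)"
    using en by (subst set_integrable_cong[OF refl refl]) auto
  have "cost b c \<gamma> = (LINT t:{b..c}|lborel. \<bar>f' t\<bar>)"
    unfolding cost_def using en by (intro set_lebesgue_integral_cong) auto
  then show "cost b c \<gamma> = integral {b..c} (\<lambda>t. \<bar>f' t\<bar>)"
    using set_borel_integral_eq_integral(2)[of "{b..c}" "\<lambda>t. \<bar>f' t\<bar>"] cont
    by (simp add: borel_integrable_atLeastAtMost' continuous_intros)
qed

lemma near_optimal_curve:
  fixes w :: "real^2"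
  assumes "b < c" "norm w = 1" "0 < \<delta>"
  shows "\<exists>\<gamma> \<in> D2 b c 0 w (- w) w. cost b c \<gamma> \<le> 1 + 2 * \<delta>"
proof -
  define L where "L = c - b"
  have "L > 0" using assms L_def by simp
  \<comment> \<open>In the rescaled time s = (t - b) / L this is the quadratic with value 0 at s =
    0, value 1 at s = 1 and initial slope -\<delta>: it runs backwards briefly, turns once, then
    runs forwards.\<close>
  define f where "f t = (1 + \<delta>) * ((t - b) / L)\<^sup>2 - \<delta> * ((t - b) / L)" for t
  define f' where "f' t = (2 * (1 + \<delta>) * ((t - b) / L) - \<delta>) / L" for t
  define f'' where "f'' t = 2 * (1 + \<delta>) / L\<^sup>2" for t :: real
  let ?\<gamma> = "\<lambda>t. f t *\<^sub>R w"
  have d1: "(f has_real_derivative f' t) (at t within {b..c})" for t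
    unfolding f_def[abs_def] f'_def using \<open>L > 0\<close>
    by (auto intro!: derivative_eq_intros simp: field_simps power2_eq_square)
  have d2: "(f' has_real_derivative f'' t) (at t within {b..c})" for t
    unfolding f'_def[abs_def] f''_def using \<open>L > 0\<close>
    by (auto intro!: derivative_eq_intros simp: field_simps power2_eq_square)
  have d3: "continuous_on {b..c} f''"
    unfolding f''_def by simp
  note curve = straight_curve[OF assms(1,2) d1 d2 d3]
  have f: "f b = 0" "f c = 1" and f': "f' b = - (\<delta> / L)" "f' c = (2 + \<delta>) / L"
    using \<open>L > 0\<close> by (auto simp: f_def f'_def L_def)
  \<comment> \<open>The excluded time is the only zero of \<open>f'\<close>, the cusp where the
    motion turns.\<close>
  have "AE t in lborel. t \<noteq> b + L * (\<delta> / (2 * (1 + \<delta>)))"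
    by (rule AE_lborel_singleton)
  then have "AE t in lborel. t \<in> {b..c} \<longrightarrow> velocity b c ?\<gamma> t \<noteq> 0"
  proof (rule AE_mp, intro AE_I2 impI)
    fix t assume "t \<noteq> b + L * (\<delta> / (2 * (1 + \<delta>)))" "t \<in> {b..c}"
    then have "f' t \<noteq> 0"
      using \<open>L > 0\<close> \<open>\<delta> > 0\<close> by (auto simp: f'_def field_simps)
    then show "velocity b c ?\<gamma> t \<noteq> 0"
      using curve(1)[OF \<open>t \<in> {b..c}\<close>] assms(2) by auto
  qed
  moreover have "same_direction (velocity b c ?\<gamma> b) (- w)"
    using curve(1)[of b] \<open>b < c\<close> f' \<open>L > 0\<close> \<open>\<delta> > 0\<close> unfolding same_direction_def
    by (intro exI[of _ "\<delta> / L"]) auto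
  moreover have "same_direction (velocity b c ?\<gamma> c) w"
    using curve(1)[of c] \<open>b < c\<close> f' \<open>L > 0\<close> \<open>\<delta> > 0\<close> unfolding same_direction_def
    by (intro exI[of _ "(2 + \<delta>) / L"]) auto
  ultimately have "?\<gamma> \<in> D2 b c 0 w (- w) w"
    unfolding D2_def using curve(2,3) f by simp
  moreover have "cost b c ?\<gamma> \<le> 1 + 2 * \<delta>"
  proof -
    have ftc: "(f' has_integral 1) {b..c}"
      using fundamental_theorem_of_calculus[of b c f f'] d1 \<open>b < c\<close> f
      by (simp add: has_real_derivative_iff_has_vector_derivative)
    have const: "((\<lambda>_. 2 * \<delta> / L) has_integral 2 * \<delta>) {b..c}"
      using has_integral_const_real[of "2 * \<delta> / L" b c] \<open>b < c\<close> \<open>L > 0\<close> by (simp add: L_def)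
    have "continuous_on {b..c} f'"
      using d2 by (meson DERIV_continuous_on)
    then have "(\<lambda>t. \<bar>f' t\<bar>) integrable_on {b..c}"
      by (intro integrable_continuous_real continuous_intros)
    then have int: "((\<lambda>t. \<bar>f' t\<bar>) has_integral cost b c ?\<gamma>) {b..c}"
      unfolding curve(4) by (rule integrable_integral)
    \<comment> \<open>The slope increases from its initial value -\<delta> / L, so its absolute
      value exceeds it by at most 2 * \<delta> / L. Over an interval of length L this adds at most 2
      * \<delta> to the displacement 1.\<close>
    have "\<bar>f' t\<bar> \<le> f' t + 2 * \<delta> / L" if "t \<in> {b..c}" for t
    proof -
      have "- (\<delta> / L) \<le> f' t"
        using that \<open>L > 0\<close> \<open>\<delta> > 0\<close> by (simp add: f'_def divide_simps)
      moreover have "0 \<le> \<delta> / L" using \<open>L > 0\<close> \<open>\<delta> > 0\<close> by simp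
      moreover have "2 * \<delta> / L = 2 * (\<delta> / L)" by simp
      ultimately show ?thesis by linarith
    qed
    then show ?thesis
      by (rule has_integral_le[OF int has_integral_add[OF ftc const]])
  qed
  ultimately show ?thesis by blast
qed

theorem proposition2:
  fixes b c :: real
  assumes "b < c"
  shows "\<exists>x0 x1 v0 v1 :: real^2. x0 \<noteq> x1 \<and> v0 \<noteq> 0 \<and> v1 \<noteq> 0 \<and>
    \<not> (\<exists>\<gamma> \<in> D2 b c x0 x1 v0 v1. \<forall>\<eta> \<in> D2 b c x0 x1 v0 v1. cost b c \<gamma> \<le> cost b c \<eta>)"
proof -
  define w :: "real^2" where "w = axis 1 1"
  have w: "norm w = 1" "w $ 1 = 1" "w \<noteq> 0"
    by (auto simp: w_def norm_axis_1 axis_eq_0_iff)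
  have False if "\<gamma> \<in> D2 b c 0 w (- w) w"
    and min: "\<forall>\<eta> \<in> D2 b c 0 w (- w) w. cost b c \<gamma> \<le> cost b c \<eta>" for \<gamma>
  proof -
    have \<gamma>: "C2_curve b c \<gamma>" "set_integrable lborel {b..c} (energy b c \<gamma>)" "\<gamma> b = 0" "\<gamma> c = w"
      "same_direction (velocity b c \<gamma> b) (- w)"
      using that(1) unfolding D2_def by auto
    then have "velocity b c \<gamma> b $ 1 < 0"
      unfolding same_direction_def using w by auto
    then have "1 < cost b c \<gamma>"
      using cost_gt_displacement[OF assms \<gamma>(1,2), of 1] \<gamma> w by simp
    \<comment> \<open>With this \<delta> the competitor has at most half the excess of \<gamma> over
      1, hence a strictly smaller cost.\<close>
    then obtain \<eta> where \<eta>: "\<eta> \<in> D2 b c 0 w (- w) w" "cost b c \<eta> \<le> 1 + 2 * ((cost b c \<gamma> - 1) / 4)"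
      using near_optimal_curve[OF assms w(1), of "(cost b c \<gamma> - 1) / 4"] by auto
    have "cost b c \<gamma> \<le> cost b c \<eta>" using min \<eta>(1) by blast
    with \<eta>(2) \<open>1 < cost b c \<gamma>\<close> show False by argo
  qed
  then show ?thesis
    using w by (intro exI[of _ 0] exI[of _ w] exI[of _ "- w"]) auto
qed

end
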